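(* Let $\sigma>0$ and $\beta>0$. Let $A:\mathcal{H}\to\mathcal{H}$ and $B:\mathcal{H}\to2^{\mathcal{H}}$ be maximally monotone, and let $A$ be $\sigma$-strongly monotone and $\tfrac1\beta$-cocoercive. Let $\gamma\in(0,\infty)$ and let the Douglas-Rachford algorithm $$z^{k+1}=\big((1-\alpha)\mathrm{Id}+\alpha R_{\gamma A}R_{\gamma B}\big)z^k$$ be applied to solve $0\in\gamma Ax+\gamma Bx$. Let $\delta=\sqrt{1-\frac{4\gamma\sigma}{1+2\gamma\sigma+\gamma^2\sigma\beta}}$. Then the algorithm converges at least with rate factor $$|1-\alpha|+\alpha\delta$$ for all $\alpha\in\big(0,\tfrac{2}{1+\delta}\big)$. Moreover, minimizing this bound with respect to $\alpha$ and $\gamma$ (over $\gamma\in(0,\infty)$ and $\alpha\in(0,\tfrac{2}{1+\delta})$) gives $\alpha=1$ and $\gamma=\frac{1}{\sqrt{\beta\sigma}}$, and the corresponding optimal rate bound is $\sqrt{\frac{\sqrt{\beta/\sigma}-1}{\sqrt{\beta/\sigma}+1}}$.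
   Context: $\mathcal{H}$ is a separable real Hilbert space, $\mathcal{H}\ne\{0\}$ (so that necessarily $\sigma\le\beta$). An operator $A$ is $\sigma$-strongly monotone if $\langle u-v,x-y\rangle\ge\sigma\|x-y\|^2$ for all $u\in Ax$, $v\in Ay$. A map $A:\mathcal{H}\to\mathcal{H}$ is $\tfrac1\beta$-cocoercive if $\langle Ax-Ay,x-y\rangle\ge\tfrac1\beta\|Ax-Ay\|^2$ for all $x,y$. For a maximally monotone operator $M$, the resolvent is $J_M=(\mathrm{Id}+M)^{-1}$ and the reflected resolvent is $R_M=2J_M-\mathrm{Id}$; both are single-valued with full domain. The algorithm "converges at least with rate factor $\rho$" means that $\rho\in[0,1)$, that the iteration operator $T=(1-\alpha)\mathrm{Id}+\alpha R_{\gamma A}R_{\gamma B}$ has a unique fixed point $\bar z$, and that $\|z^{k+1}-\bar z\|\le\rho\|z^k-\bar z\|$ for all $k\geq 0$ and every starting point $z^0\in\mathcal{H}$. *)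

theory Defs
  imports "HOL-Analysis.Analysis"
begin

text \<open>A set-valued operator on \<open>'a\<close> is a function \<open>'a \<Rightarrow> 'a set\<close>, its graph being
  the set of pairs \<open>(x, u)\<close> with \<open>u \<in> M x\<close>.\<close>

definition single_valued_op :: "('a \<Rightarrow> 'a) \<Rightarrow> 'a \<Rightarrow> 'a set" where
  "single_valued_op A = (\<lambda>x. {A x})"

definition scaled_op :: "real \<Rightarrow> ('a::real_vector \<Rightarrow> 'a set) \<Rightarrow> 'a \<Rightarrow> 'a set" where
  "scaled_op \<gamma> M = (\<lambda>x. (\<lambda>u. \<gamma> *\<^sub>R u) ` M x)"

definition monotone_op :: "('a::real_inner \<Rightarrow> 'a set) \<Rightarrow> bool" where
  "monotone_op M \<longleftrightarrow> (\<forall>x y. \<forall>u\<in>M x. \<forall>v\<in>M y. inner (u - v) (x - y) \<ge> 0)"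

definition maximally_monotone :: "('a::real_inner \<Rightarrow> 'a set) \<Rightarrow> bool" where
  "maximally_monotone M \<longleftrightarrow>
     monotone_op M \<and> (\<forall>N. monotone_op N \<and> (\<forall>x. M x \<subseteq> N x) \<longrightarrow> N = M)"

definition strongly_monotone :: "real \<Rightarrow> ('a::real_inner \<Rightarrow> 'a set) \<Rightarrow> bool" where
  "strongly_monotone \<sigma> M \<longleftrightarrow>
     (\<forall>x y. \<forall>u\<in>M x. \<forall>v\<in>M y. inner (u - v) (x - y) \<ge> \<sigma> * (norm (x - y))\<^sup>2)"

definition cocoercive :: "real \<Rightarrow> ('a::real_inner \<Rightarrow> 'a) \<Rightarrow> bool" where
  "cocoercive c A \<longleftrightarrow>
     (\<forall>x y. inner (A x - A y) (x - y) \<ge> c * (norm (A x - A y))\<^sup>2)"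

text \<open>The resolvent \<open>(Id + M)\<^sup>-\<^sup>1\<close> sends \<open>z\<close> to the \<open>x\<close> with \<open>z \<in> x + M x\<close>.  For maximally
  monotone \<open>M\<close> on a Hilbert space this \<open>x\<close> exists and is unique (Minty); for other \<open>M\<close>
  the value of the description operator may be unspecified.\<close>

definition resolvent :: "('a::real_vector \<Rightarrow> 'a set) \<Rightarrow> 'a \<Rightarrow> 'a" where
  "resolvent M z = (THE x. z \<in> (\<lambda>u. x + u) ` M x)"

definition reflected_resolvent :: "('a::real_vector \<Rightarrow> 'a set) \<Rightarrow> 'a \<Rightarrow> 'a" where
  "reflected_resolvent M z = 2 *\<^sub>R resolvent M z - z"

definition DR_operator ::
    "real \<Rightarrow> real \<Rightarrow> ('a::real_vector \<Rightarrow> 'a set) \<Rightarrow> ('a \<Rightarrow> 'a set) \<Rightarrow> 'a \<Rightarrow> 'a" where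
  "DR_operator \<alpha> \<gamma> A B z =
     (1 - \<alpha>) *\<^sub>R z
     + \<alpha> *\<^sub>R reflected_resolvent (scaled_op \<gamma> A) (reflected_resolvent (scaled_op \<gamma> B) z)"

definition converges_with_rate_factor :: "('a::real_normed_vector \<Rightarrow> 'a) \<Rightarrow> real \<Rightarrow> bool" where
  "converges_with_rate_factor T \<rho> \<longleftrightarrow>
     0 \<le> \<rho> \<and> \<rho> < 1 \<and>
     (\<exists>zbar. (\<forall>z. T z = z \<longleftrightarrow> z = zbar) \<and>
        (\<forall>z0 k. norm ((T ^^ Suc k) z0 - zbar) \<le> \<rho> * norm ((T ^^ k) z0 - zbar)))"

definition DR_delta :: "real \<Rightarrow> real \<Rightarrow> real \<Rightarrow> real" where
  "DR_delta \<sigma> \<beta> \<gamma> = sqrt (1 - 4 * \<gamma> * \<sigma> / (1 + 2 * \<gamma> * \<sigma> + \<gamma>\<^sup>2 * \<sigma> * \<beta>))"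

definition DR_rate_bound :: "real \<Rightarrow> real \<Rightarrow> real \<Rightarrow> real \<Rightarrow> real" where
  "DR_rate_bound \<sigma> \<beta> \<alpha> \<gamma> = \<bar>1 - \<alpha>\<bar> + \<alpha> * DR_delta \<sigma> \<beta> \<gamma>"

definition DR_admissible :: "real \<Rightarrow> real \<Rightarrow> real \<Rightarrow> real \<Rightarrow> bool" where
  "DR_admissible \<sigma> \<beta> \<alpha> \<gamma> \<longleftrightarrow> 0 < \<gamma> \<and> 0 < \<alpha> \<and> \<alpha> < 2 / (1 + DR_delta \<sigma> \<beta> \<gamma>)"

end

theory Submission
  imports Defs
begin

text \<open>
  The convergence claim combines three facts.

  \<^item> For a maximally monotone \<open>M\<close> the resolvent is defined everywhere (Minty's theorem), and the
    reflected resolvent is nonexpansive.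
  \<^item> Let \<open>x\<close>, \<open>y\<close> be the resolvents of \<open>\<gamma>A\<close> at \<open>z\<close>, \<open>w\<close>, and put \<open>d = x - y\<close>, \<open>a = A x - A y\<close>.  Then
    \<open>z - w = d + \<gamma>a\<close>, while the reflected resolvents differ by \<open>d - \<gamma>a\<close>, so the squared norms
    of the two differ by \<open>4\<gamma>\<langle>a,d\<rangle>\<close>.  As \<open>\<sigma>|d|\<^sup>2 \<le> \<langle>a,d\<rangle>\<close> and \<open>|a|\<^sup>2 \<le> \<beta>\<langle>a,d\<rangle>\<close>, expanding \<open>|d + \<gamma>a|\<^sup>2\<close>
    bounds it by \<open>(1 + 2\<gamma>\<sigma> + \<gamma>\<^sup>2\<sigma>\<beta>)\<langle>a,d\<rangle>/\<sigma>\<close>, and the reflected resolvent of \<open>\<gamma>A\<close> contracts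
    distances by the factor \<open>\<delta>\<close>.
  \<^item> The relaxed composition is therefore Lipschitz with constant \<open>|1-\<alpha>| + \<alpha>\<delta>\<close>, which is less than
    \<open>1\<close> on the stated range of \<open>\<alpha>\<close>, and Banach's fixed point theorem applies.

  Minty's theorem is obtained from the Fitzpatrick function \<open>F(x,u) = sup \<langle>x,b\<rangle> + \<langle>a,u\<rangle> - \<langle>a,b\<rangle>\<close>,
  the supremum being over the pairs \<open>(a,b)\<close> in the graph of \<open>M\<close>.  Adding \<open>|(x,u)|\<^sup>2/2\<close> gives a
  strongly convex lower semicontinuous function, which has a minimiser by completeness alone, with
  no appeal to weak compactness.  The quadratic growth at the minimiser \<open>(x\<^sub>0,u\<^sub>0)\<close>, evaluated on the
  graph of \<open>M\<close>, says that \<open>(-u\<^sub>0,-x\<^sub>0)\<close> is monotonically related to the graph, hence lies in it,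
  and also that \<open>x\<^sub>0 + u\<^sub>0 = 0\<close>.  Thus \<open>-x\<^sub>0 \<in> M x\<^sub>0\<close>.

  For the optimal parameters, \<open>|1-\<alpha>| + \<alpha>\<delta> \<ge> \<delta>\<close> with equality only at \<open>\<alpha> = 1\<close>, and the arithmetic-geometric
  mean inequality for \<open>1/\<gamma>\<close> and \<open>\<gamma>\<sigma>\<beta>\<close> shows that \<open>\<delta>\<close> is smallest exactly at
  \<open>\<gamma> = 1/\<surd>(\<beta>\<sigma>)\<close>.
\<close>

section \<open>Minimisation of strongly convex suprema of affine functions\<close>

text \<open>The sublevel set at height \<open>t\<close> of the function
  \<open>p \<mapsto> (sup \<langle>w,p\<rangle> - c) + |p|\<^sup>2/2\<close>, where \<open>(w,c)\<close> ranges over \<open>W\<close>.  Working with sublevel sets avoids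
  a supremum that may be infinite.\<close>

definition sublevel :: "('b::real_inner \<times> real) set \<Rightarrow> real \<Rightarrow> 'b set" where
  "sublevel W t = {p. \<forall>(w, c)\<in>W. inner w p - c + (norm p)\<^sup>2 / 2 \<le> t}"

lemma norm_sq_convex_combination:
  fixes p q :: "'b::real_inner"
  shows "(norm ((1 - s) *\<^sub>R p + s *\<^sub>R q))\<^sup>2
       = (1 - s) * (norm p)\<^sup>2 + s * (norm q)\<^sup>2 - s * (1 - s) * (norm (p - q))\<^sup>2"
  unfolding power2_norm_eq_inner
  by (simp add: inner_add_left inner_add_right inner_diff_left inner_diff_right inner_commute
      algebra_simps power2_eq_square)

lemma sublevel_convex_combination:
  assumes p: "p \<in> sublevel W t" and q: "q \<in> sublevel W t'" and s: "0 \<le> s" "s \<le> 1"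
  shows "(1 - s) *\<^sub>R p + s *\<^sub>R q
           \<in> sublevel W ((1 - s) * t + s * t' - s * (1 - s) * (norm (p - q))\<^sup>2 / 2)"
  unfolding sublevel_def
proof clarify
  fix w c assume wc: "(w, c) \<in> W"
  have 1: "(1 - s) * (inner w p - c + (norm p)\<^sup>2 / 2) \<le> (1 - s) * t"
    using p wc s by (intro mult_left_mono) (auto simp: sublevel_def)
  have 2: "s * (inner w q - c + (norm q)\<^sup>2 / 2) \<le> s * t'"
    using q wc s by (intro mult_left_mono) (auto simp: sublevel_def)
  have "inner w ((1 - s) *\<^sub>R p + s *\<^sub>R q) - c + (norm ((1 - s) *\<^sub>R p + s *\<^sub>R q))\<^sup>2 / 2
      = (1 - s) * (inner w p - c + (norm p)\<^sup>2 / 2) + s * (inner w q - c + (norm q)\<^sup>2 / 2)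
        - s * (1 - s) * (norm (p - q))\<^sup>2 / 2"
    unfolding norm_sq_convex_combination inner_add_right inner_scaleR_right
    by (simp add: field_simps)
  with 1 2 show "inner w ((1 - s) *\<^sub>R p + s *\<^sub>R q) - c + (norm ((1 - s) *\<^sub>R p + s *\<^sub>R q))\<^sup>2 / 2
      \<le> (1 - s) * t + s * t' - s * (1 - s) * (norm (p - q))\<^sup>2 / 2"
    by linarith
qed

lemma closed_sublevel: "closed (sublevel W t)"
proof -
  have "sublevel W t = (\<Inter>(w, c)\<in>W. {p. inner w p - c + (norm p)\<^sup>2 / 2 \<le> t})"
    by (auto simp: sublevel_def)
  also have "closed \<dots>"
    by (intro closed_INT ballI) (auto intro!: closed_Collect_le continuous_intros)
  finally show ?thesis .
qed

text \<open>Near the infimum \<open>m\<close> the sublevel sets have small diameter, by strong convexity, so their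
  intersection is nonempty by Cantor's theorem.\<close>

lemma strongly_convex_minimiser:
  fixes W :: "('b::{real_inner, complete_space} \<times> real) set"
  assumes nonempty: "sublevel W t0 \<noteq> {}"
    and bounded: "\<And>t. sublevel W t \<noteq> {} \<Longrightarrow> K \<le> t"
  obtains p0 m where "p0 \<in> sublevel W m"
    and "\<And>p t. p \<in> sublevel W t \<Longrightarrow> m + (norm (p - p0))\<^sup>2 / 2 \<le> t"
proof -
  define T where "T = {t. sublevel W t \<noteq> {}}"
  define m where "m = Inf T"
  have bdd: "bdd_below T" using bounded by (auto simp: T_def intro!: bdd_belowI[of _ K])
  have m_le: "m \<le> t" if "p \<in> sublevel W t" for p t
    unfolding m_def using that bdd by (intro cInf_lower) (auto simp: T_def)
  have mono: "sublevel W t \<subseteq> sublevel W t'" if "t \<le> t'" for t t'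
    using that by (force simp: sublevel_def)
  define S where "S n = sublevel W (m + 1 / real (Suc n))" for n
  have "S n \<noteq> {}" for n
  proof -
    have "\<exists>t\<in>T. t < m + 1 / real (Suc n)"
      unfolding m_def using nonempty bdd by (intro cInf_less_iff[THEN iffD1]) (auto simp: T_def)
    then show ?thesis using mono unfolding S_def T_def
      by (metis (mono_tags, lifting) less_le mem_Collect_eq subset_empty)
  qed
  moreover have "closed (S n)" for n by (simp add: S_def closed_sublevel)
  moreover have "S n \<subseteq> S k" if "k \<le> n" for k n
    unfolding S_def using that by (intro mono) (simp add: frac_le)
  moreover have "\<exists>n. \<forall>p\<in>S n. \<forall>q\<in>S n. dist p q < e" if e: "e > 0" for e
  proof -
    obtain n where n: "1 / real (Suc n) < e\<^sup>2 / 8"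
      using e by (metis nat_approx_posE zero_less_divide_iff zero_less_numeral zero_less_power)
    have "dist p q < e" if "p \<in> S n" "q \<in> S n" for p q
    proof -
      \<comment> \<open>the value at the midpoint is at most \<open>m + 1/(n+1) - |p - q|\<^sup>2/8\<close>, and at least \<open>m\<close>\<close>
      have "m \<le> m + 1 / real (Suc n) - (norm (p - q))\<^sup>2 / 8"
        using m_le[OF sublevel_convex_combination[OF that[unfolded S_def], of "1/2"]]
        by (simp add: field_simps del: of_nat_Suc)
      with n have "(norm (p - q))\<^sup>2 < e\<^sup>2" by linarith
      then show ?thesis using e by (simp add: dist_norm power_less_imp_less_base)
    qed
    then show ?thesis by blast
  qed
  ultimately obtain p0 where p0: "\<And>n. p0 \<in> S n"
    using decreasing_closed_nest[of S] by metis
  have p0m: "p0 \<in> sublevel W m"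
    unfolding sublevel_def
  proof clarify
    fix w c assume wc: "(w, c) \<in> W"
    show "inner w p0 - c + (norm p0)\<^sup>2 / 2 \<le> m"
    proof (rule field_le_epsilon)
      fix e :: real assume "e > 0"
      then obtain n where "1 / real (Suc n) < e" by (rule nat_approx_posE)
      moreover have "inner w p0 - c + (norm p0)\<^sup>2 / 2 \<le> m + 1 / real (Suc n)"
        using p0[of n] wc by (auto simp: S_def sublevel_def)
      ultimately show "inner w p0 - c + (norm p0)\<^sup>2 / 2 \<le> m + e" by linarith
    qed
  qed
  have growth: "m + (norm (p - p0))\<^sup>2 / 2 \<le> t" if p: "p \<in> sublevel W t" for p t
  proof -
    define D where "D = (norm (p - p0))\<^sup>2 / 2"
    have D: "D \<ge> 0" by (simp add: D_def)
    have *: "(1 - s) * D \<le> t - m" if s: "0 < s" "s \<le> 1" for s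
    proof -
      have "m \<le> (1 - s) * m + s * t - s * (1 - s) * D"
        using m_le[OF sublevel_convex_combination[OF p0m p, of s]] s
        by (simp add: D_def norm_minus_commute)
      then have "s * ((1 - s) * D) \<le> s * (t - m)" by (simp add: algebra_simps)
      then show ?thesis using s by simp
    qed
    have "((\<lambda>s. (1 - s) * D) \<longlongrightarrow> (1 - 0) * D) (at_right 0)"
      by (intro tendsto_intros)
    moreover have "\<forall>\<^sub>F s in at_right (0::real). (1 - s) * D \<le> t - m"
      using eventually_at_right_real[OF zero_less_one]
      by (rule eventually_mono) (auto intro!: *)
    ultimately have "(1 - 0) * D \<le> t - m"
      by (intro tendsto_upperbound) auto
    then show ?thesis by (simp add: D_def)
  qed
  from p0m growth show ?thesis by (rule that)
qed

section \<open>Maximally monotone operators and their resolvents\<close>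

lemma monotone_opD:
  "monotone_op M \<Longrightarrow> u \<in> M x \<Longrightarrow> v \<in> M y \<Longrightarrow> 0 \<le> inner (u - v) (x - y)"
  by (auto simp: monotone_op_def)

lemma maximally_monotone_iff:
  "maximally_monotone M \<longleftrightarrow>
     monotone_op M \<and> (\<forall>x u. (\<forall>y. \<forall>v\<in>M y. 0 \<le> inner (u - v) (x - y)) \<longrightarrow> u \<in> M x)"
  (is "_ \<longleftrightarrow> _ \<and> ?related")
proof (intro iffI conjI)
  assume max: "maximally_monotone M"
  then show mono: "monotone_op M" by (simp add: maximally_monotone_def)
  show ?related
  proof (intro allI impI)
    fix x u assume rel: "\<forall>y. \<forall>v\<in>M y. 0 \<le> inner (u - v) (x - y)"
    define N where "N = M(x := insert u (M x))"
    have swap: "0 \<le> inner (v - u) (y - x)" if "v \<in> M y" for v y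
    proof -
      have "inner (v - u) (y - x) = inner (u - v) (x - y)"
        by (simp add: inner_diff_left inner_diff_right)
      with rel that show ?thesis by simp
    qed
    have "monotone_op N"
      unfolding monotone_op_def N_def
      using rel swap monotone_opD[OF mono] by (auto split: if_splits)
    moreover have "\<forall>x. M x \<subseteq> N x" by (auto simp: N_def)
    ultimately have "N = M" using max by (auto simp: maximally_monotone_def)
    then show "u \<in> M x" by (metis N_def fun_upd_same insertI1)
  qed
next
  assume *: "monotone_op M \<and> ?related"
  have "N = M" if N: "monotone_op N" "\<forall>x. M x \<subseteq> N x" for N
  proof (intro ext equalityI subsetI)
    fix x u assume "u \<in> N x"
    then show "u \<in> M x" using * N by (meson monotone_opD subsetD)
  qed (use N in auto)
  with * show "maximally_monotone M" by (auto simp: maximally_monotone_def)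
qed

lemma maximally_monotoneD:
  assumes "maximally_monotone M" and "\<And>y v. v \<in> M y \<Longrightarrow> 0 \<le> inner (u - v) (x - y)"
  shows "u \<in> M x"
  using assms unfolding maximally_monotone_iff by blast

lemma maximally_monotone_imp_monotone: "maximally_monotone M \<Longrightarrow> monotone_op M"
  by (simp add: maximally_monotone_def)

lemma maximally_monotone_scale_translate:
  fixes M :: "'a::real_inner \<Rightarrow> 'a set"
  assumes max: "maximally_monotone M" and g: "0 < \<gamma>"
  shows "maximally_monotone (\<lambda>x. (\<lambda>u. \<gamma> *\<^sub>R u - z) ` M x)"
  unfolding maximally_monotone_iff
proof (intro conjI allI impI)
  have "(\<gamma> *\<^sub>R u - z) - (\<gamma> *\<^sub>R v - z) = \<gamma> *\<^sub>R (u - v)" for u v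
    by (simp add: algebra_simps)
  then show "monotone_op (\<lambda>x. (\<lambda>u. \<gamma> *\<^sub>R u - z) ` M x)"
    using g monotone_opD[OF maximally_monotone_imp_monotone[OF max]]
    by (auto simp: monotone_op_def)
next
  fix x u
  assume rel: "\<forall>y. \<forall>v\<in>(\<lambda>u. \<gamma> *\<^sub>R u - z) ` M y. 0 \<le> inner (u - v) (x - y)"
  define u' where "u' = (u + z) /\<^sub>R \<gamma>"
  have u: "u = \<gamma> *\<^sub>R u' - z" using g by (simp add: u'_def)
  have "u' \<in> M x"
  proof (rule maximally_monotoneD[OF max])
    fix y v assume "v \<in> M y"
    with rel have "0 \<le> inner (u - (\<gamma> *\<^sub>R v - z)) (x - y)" by blast
    also have "u - (\<gamma> *\<^sub>R v - z) = \<gamma> *\<^sub>R (u' - v)" by (simp add: u algebra_simps)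
    finally show "0 \<le> inner (u' - v) (x - y)" using g by (simp add: zero_le_mult_iff)
  qed
  then show "u \<in> (\<lambda>u. \<gamma> *\<^sub>R u - z) ` M x" by (auto simp: u)
qed

lemma maximally_monotone_scaled_op:
  assumes "maximally_monotone M" and "0 < \<gamma>"
  shows "maximally_monotone (scaled_op \<gamma> M)"
  using maximally_monotone_scale_translate[OF assms, of 0] by (simp add: scaled_op_def)

lemma maximally_monotone_nonempty:
  assumes "maximally_monotone M"
  obtains x u where "u \<in> M x"
  using maximally_monotoneD[OF assms, of 0 0] by blast

text \<open>Minty's theorem at the origin.  The affine functions below are those whose supremum is the
  Fitzpatrick function of \<open>M\<close>; maximality bounds the minimised function below by \<open>0\<close>.\<close>

lemma minty_origin:
  fixes M :: "'a::{real_inner, complete_space} \<Rightarrow> 'a set"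
  assumes max: "maximally_monotone M"
  obtains x where "- x \<in> M x"
proof -
  define W where "W = {((b, a), inner a b) | a b. b \<in> M a}"
  have mono: "0 \<le> inner (u - v) (x - y)" if "u \<in> M x" "v \<in> M y" for x y u v
    using maximally_monotone_imp_monotone[OF max] that by (rule monotone_opD)
  have mem: "(x, u) \<in> sublevel W t \<longleftrightarrow>
      (\<forall>a. \<forall>b\<in>M a. inner x u - inner (u - b) (x - a) + ((norm x)\<^sup>2 + (norm u)\<^sup>2) / 2 \<le> t)"
    for x u t
  proof -
    have "inner (b, a) (x, u) - inner a b + (norm (x, u))\<^sup>2 / 2
        = inner x u - inner (u - b) (x - a) + ((norm x)\<^sup>2 + (norm u)\<^sup>2) / 2" for a b
      by (simp add: norm_prod_def inner_diff_left inner_diff_right inner_commute)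
    then show ?thesis unfolding sublevel_def W_def by fastforce
  qed
  have nonneg: "0 \<le> t" if xu: "(x, u) \<in> sublevel W t" for x u t
  proof (rule ccontr)
    assume "\<not> 0 \<le> t"
    have sq: "inner x u + ((norm x)\<^sup>2 + (norm u)\<^sup>2) / 2 = (norm (x + u))\<^sup>2 / 2"
      unfolding power2_norm_eq_inner
      by (simp add: inner_add_left inner_add_right inner_commute field_simps)
    have lower: "(norm (x + u))\<^sup>2 / 2 - inner (u - b) (x - a) \<le> t" if "b \<in> M a" for a b
    proof -
      have "inner x u - inner (u - b) (x - a) + ((norm x)\<^sup>2 + (norm u)\<^sup>2) / 2 \<le> t"
        using xu that unfolding mem by blast
      with sq show ?thesis by linarith
    qed
    have "u \<in> M x"
    proof (rule maximally_monotoneD[OF max])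
      fix a b assume "b \<in> M a"
      from lower[OF this] \<open>\<not> 0 \<le> t\<close> zero_le_power2[of "norm (x + u)"]
      show "0 \<le> inner (u - b) (x - a)" by linarith
    qed
    from lower[OF this] \<open>\<not> 0 \<le> t\<close> zero_le_power2[of "norm (x + u)"]
    show False by simp
  qed
  have graph: "(a, b) \<in> sublevel W (inner a b + ((norm a)\<^sup>2 + (norm b)\<^sup>2) / 2)"
    if "b \<in> M a" for a b
    unfolding mem using mono[OF that] by fastforce
  obtain a1 b1 where ab1: "b1 \<in> M a1" using maximally_monotone_nonempty[OF max] .
  obtain p0 m where p0: "p0 \<in> sublevel W m"
    and growth: "\<And>p t. p \<in> sublevel W t \<Longrightarrow> m + (norm (p - p0))\<^sup>2 / 2 \<le> t"
  proof (rule strongly_convex_minimiser[of W _ 0])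
    show "sublevel W (inner a1 b1 + ((norm a1)\<^sup>2 + (norm b1)\<^sup>2) / 2) \<noteq> {}"
      using graph[OF ab1] by blast
  next
    fix t assume "sublevel W t \<noteq> {}"
    then show "0 \<le> t" using nonneg by fastforce
  qed blast
  obtain x0 u0 where xu0: "p0 = (x0, u0)" by (cases p0)
  have m: "0 \<le> m" using nonneg p0 xu0 by blast
  have key: "(norm (x0 + u0))\<^sup>2 / 2 \<le> inner (- x0 - b) (- u0 - a)" if ba: "b \<in> M a" for a b
  proof -
    have "m + ((norm (a - x0))\<^sup>2 + (norm (b - u0))\<^sup>2) / 2
        \<le> inner a b + ((norm a)\<^sup>2 + (norm b)\<^sup>2) / 2"
      using growth[OF graph[OF ba]] by (simp add: xu0 norm_prod_def)
    with m show ?thesis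
      unfolding power2_norm_eq_inner
      by (simp add: inner_add_left inner_add_right inner_diff_left inner_diff_right
          inner_commute field_simps)
  qed
  have mem0: "- x0 \<in> M (- u0)"
  proof (rule maximally_monotoneD[OF max])
    fix a b assume "b \<in> M a"
    from key[OF this] zero_le_power2[of "norm (x0 + u0)"]
    show "0 \<le> inner (- x0 - b) (- u0 - a)" by linarith
  qed
  from key[OF mem0] have "x0 + u0 = 0" by simp
  then have "- u0 = x0" by (simp add: add_eq_0_iff)
  with mem0 that show ?thesis by metis
qed

theorem minty:
  fixes M :: "'a::{real_inner, complete_space} \<Rightarrow> 'a set"
  assumes max: "maximally_monotone M"
  obtains x where "z - x \<in> M x"
proof -
  obtain x where "- x \<in> (\<lambda>u. 1 *\<^sub>R u - z) ` M x"
    using minty_origin[OF maximally_monotone_scale_translate[OF max, of 1 z]] by auto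
  then obtain u where "u \<in> M x" "- x = u - z" by auto
  then have "z - x \<in> M x" by (metis add.commute diff_add_cancel uminus_add_conv_diff)
  then show ?thesis by (rule that)
qed

lemma resolvent_spec:
  fixes M :: "'a::{real_inner, complete_space} \<Rightarrow> 'a set"
  assumes max: "maximally_monotone M"
  shows "z - resolvent M z \<in> M (resolvent M z)"
proof -
  have eq: "z \<in> (\<lambda>u. x + u) ` M x \<longleftrightarrow> z - x \<in> M x" for x
    by (auto simp: image_iff intro: bexI[of _ "z - x"])
  obtain x where x: "z - x \<in> M x" using minty[OF max] .
  have "y = x" if "z - y \<in> M y" for y
  proof -
    have "0 \<le> inner ((z - y) - (z - x)) (y - x)"
      using maximally_monotone_imp_monotone[OF max] that x by (rule monotone_opD)
    also have "(z - y) - (z - x) = - (y - x)" by simp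
    finally have "(norm (y - x))\<^sup>2 \<le> 0"
      by (simp add: power2_norm_eq_inner del: minus_diff_eq)
    then show ?thesis by simp
  qed
  with x have "(THE x. z - x \<in> M x) = x" by (rule the_equality)
  with x show ?thesis by (simp add: resolvent_def eq)
qed

lemma reflected_resolvent_nonexpansive:
  fixes M :: "'a::{real_inner, complete_space} \<Rightarrow> 'a set"
  assumes max: "maximally_monotone M"
  shows "norm (reflected_resolvent M z - reflected_resolvent M w) \<le> norm (z - w)"
proof -
  define d where "d = resolvent M z - resolvent M w"
  define e where "e = (z - w) - d"
  have "0 \<le> inner ((z - resolvent M z) - (w - resolvent M w)) d"
    unfolding d_def using maximally_monotone_imp_monotone[OF max]
    by (rule monotone_opD) (intro resolvent_spec max)+
  also have "(z - resolvent M z) - (w - resolvent M w) = e" by (simp add: d_def e_def)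
  finally have "0 \<le> inner e d" .
  then have "(norm (d - e))\<^sup>2 \<le> (norm (d + e))\<^sup>2"
    unfolding power2_norm_eq_inner
    by (simp add: inner_add_left inner_add_right inner_diff_left inner_diff_right inner_commute)
  moreover have "reflected_resolvent M z - reflected_resolvent M w = d - e"
    by (simp add: reflected_resolvent_def d_def e_def scaleR_2)
  moreover have "z - w = d + e" by (simp add: e_def)
  ultimately show ?thesis by (metis norm_ge_zero power2_le_imp_le)
qed

section \<open>Contraction of the reflected resolvent and of the iteration\<close>

text \<open>On the zero space every \<open>\<sigma>\<close> and \<open>\<beta>\<close> satisfy the other hypotheses, so the space has to be
  nontrivial.\<close>

lemma strong_monotonicity_le_cocoercivity:
  fixes A :: "'a::real_inner \<Rightarrow> 'a"
  assumes nontriv: "(UNIV :: 'a set) \<noteq> {0}" and s: "0 < \<sigma>" and b: "0 < \<beta>"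
    and strong: "strongly_monotone \<sigma> (single_valued_op A)" and coco: "cocoercive (1 / \<beta>) A"
  shows "\<sigma> \<le> \<beta>"
proof -
  obtain x :: 'a where x: "x \<noteq> 0" using nontriv by auto
  define a where "a = A x - A 0"
  have 1: "\<sigma> * (norm x)\<^sup>2 \<le> inner a x"
    using strong unfolding strongly_monotone_def single_valued_op_def a_def
    by (metis diff_zero singletonI)
  have 2: "(norm a)\<^sup>2 \<le> \<beta> * inner a x"
    using coco b unfolding cocoercive_def a_def
    by (metis diff_zero mult.commute mult_1 pos_divide_le_eq times_divide_eq_left)
  have CS: "inner a x \<le> norm a * norm x" by (rule norm_cauchy_schwarz)
  have nx: "0 < norm x" using x by simp
  have "\<sigma> * norm x * norm x \<le> norm a * norm x"
    using 1 CS by (simp add: power2_eq_square mult.assoc)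
  then have lower: "\<sigma> * norm x \<le> norm a" using nx by simp
  then have na: "0 < norm a" using s nx by (meson less_le_trans mult_pos_pos)
  have "norm a * norm a \<le> norm a * (\<beta> * norm x)"
    using order_trans[OF 2 mult_left_mono[OF CS, of \<beta>]] b by (simp add: power2_eq_square mult_ac)
  then have "norm a \<le> \<beta> * norm x" using na by simp
  with lower have "\<sigma> * norm x \<le> \<beta> * norm x" by linarith
  then show ?thesis using nx by simp
qed

lemma DR_delta_denominator_pos:
  fixes \<sigma> \<beta> \<gamma> :: real
  assumes "0 < \<sigma>" "0 < \<beta>" "0 < \<gamma>"
  shows "0 < 1 + 2 * \<gamma> * \<sigma> + \<gamma>\<^sup>2 * \<sigma> * \<beta>"
  using assms by (intro add_pos_pos mult_pos_pos) auto

text \<open>The radicand equals \<open>((1-\<gamma>\<sigma>)\<^sup>2 + \<gamma>\<^sup>2\<sigma>(\<beta>-\<sigma>))/(1 + 2\<gamma>\<sigma> + \<gamma>\<^sup>2\<sigma>\<beta>)\<close>.\<close>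

lemma DR_delta_radicand_nonneg:
  fixes \<sigma> \<beta> \<gamma> :: real
  assumes "0 < \<sigma>" "\<sigma> \<le> \<beta>" "0 < \<gamma>"
  shows "0 \<le> 1 - 4 * \<gamma> * \<sigma> / (1 + 2 * \<gamma> * \<sigma> + \<gamma>\<^sup>2 * \<sigma> * \<beta>)"
proof -
  have D: "0 < 1 + 2 * \<gamma> * \<sigma> + \<gamma>\<^sup>2 * \<sigma> * \<beta>"
    using assms by (intro DR_delta_denominator_pos) auto
  have "0 \<le> (1 - \<gamma> * \<sigma>)\<^sup>2 + \<gamma>\<^sup>2 * \<sigma> * (\<beta> - \<sigma>)" using assms by simp
  also have "\<dots> = (1 + 2 * \<gamma> * \<sigma> + \<gamma>\<^sup>2 * \<sigma> * \<beta>) - 4 * \<gamma> * \<sigma>"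
    by (simp add: power2_eq_square algebra_simps)
  finally show ?thesis using D by (simp add: field_simps)
qed

lemma DR_delta_bounds:
  assumes "0 < \<sigma>" "\<sigma> \<le> \<beta>" "0 < \<gamma>"
  shows "0 \<le> DR_delta \<sigma> \<beta> \<gamma>" "DR_delta \<sigma> \<beta> \<gamma> < 1"
proof -
  have "0 < 4 * \<gamma> * \<sigma> / (1 + 2 * \<gamma> * \<sigma> + \<gamma>\<^sup>2 * \<sigma> * \<beta>)"
    using assms DR_delta_denominator_pos[of \<sigma> \<beta> \<gamma>] by simp
  then show "DR_delta \<sigma> \<beta> \<gamma> < 1" by (simp add: DR_delta_def)
  show "0 \<le> DR_delta \<sigma> \<beta> \<gamma>"
    using DR_delta_radicand_nonneg[OF assms] by (simp add: DR_delta_def)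
qed

lemma reflected_resolvent_contraction:
  fixes A :: "'a::{real_inner, complete_space} \<Rightarrow> 'a"
  assumes s: "0 < \<sigma>" "\<sigma> \<le> \<beta>" and g: "0 < \<gamma>"
    and max: "maximally_monotone (single_valued_op A)"
    and strong: "strongly_monotone \<sigma> (single_valued_op A)" and coco: "cocoercive (1 / \<beta>) A"
  shows "norm (reflected_resolvent (scaled_op \<gamma> (single_valued_op A)) z
               - reflected_resolvent (scaled_op \<gamma> (single_valued_op A)) w)
         \<le> DR_delta \<sigma> \<beta> \<gamma> * norm (z - w)"
proof -
  let ?M = "scaled_op \<gamma> (single_valued_op A)"
  let ?D = "1 + 2 * \<gamma> * \<sigma> + \<gamma>\<^sup>2 * \<sigma> * \<beta>"
  have b: "0 < \<beta>" using s by linarith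
  have D: "0 < ?D" using s(1) b g by (rule DR_delta_denominator_pos)
  have spec: "z - resolvent ?M z = \<gamma> *\<^sub>R A (resolvent ?M z)" for z
    using resolvent_spec[OF maximally_monotone_scaled_op[OF max g], of z]
    by (simp add: scaled_op_def single_valued_op_def)
  define d where "d = resolvent ?M z - resolvent ?M w"
  define a where "a = A (resolvent ?M z) - A (resolvent ?M w)"
  define i where "i = inner a d"
  have "(z - resolvent ?M z) - (w - resolvent ?M w) = \<gamma> *\<^sub>R a"
    unfolding spec by (simp add: a_def scaleR_diff_right)
  then have zw: "z - w = d + \<gamma> *\<^sub>R a" by (simp add: d_def algebra_simps)
  have R: "reflected_resolvent ?M z - reflected_resolvent ?M w = d - \<gamma> *\<^sub>R a"
  proof -
    have "reflected_resolvent ?M z - reflected_resolvent ?M w = 2 *\<^sub>R d - (z - w)"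
      by (simp add: reflected_resolvent_def d_def algebra_simps)
    then show ?thesis by (simp add: zw scaleR_2)
  qed
  have di: "\<sigma> * (norm d)\<^sup>2 \<le> i"
    using strong unfolding strongly_monotone_def single_valued_op_def a_def d_def i_def by simp
  have ai: "(norm a)\<^sup>2 \<le> \<beta> * i"
    using coco b unfolding cocoercive_def a_def d_def i_def
    by (metis mult.commute mult_1 pos_divide_le_eq times_divide_eq_left)
  have plus: "(norm (d + \<gamma> *\<^sub>R a))\<^sup>2 = (norm d)\<^sup>2 + 2 * \<gamma> * i + \<gamma>\<^sup>2 * (norm a)\<^sup>2"
    unfolding power2_norm_eq_inner i_def
    by (simp add: inner_add_left inner_add_right inner_commute power2_eq_square)
  have minus: "(norm (d - \<gamma> *\<^sub>R a))\<^sup>2 = (norm (d + \<gamma> *\<^sub>R a))\<^sup>2 - 4 * \<gamma> * i"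
    unfolding power2_norm_eq_inner i_def
    by (simp add: inner_add_left inner_add_right inner_diff_left inner_diff_right inner_commute)
  have "\<sigma> * (norm (d + \<gamma> *\<^sub>R a))\<^sup>2 = \<sigma> * (norm d)\<^sup>2 + 2 * \<gamma> * \<sigma> * i + \<gamma>\<^sup>2 * \<sigma> * (norm a)\<^sup>2"
    by (simp add: plus algebra_simps)
  also have "\<dots> \<le> i + 2 * \<gamma> * \<sigma> * i + \<gamma>\<^sup>2 * \<sigma> * (\<beta> * i)"
    using di ai s g by (intro add_mono mult_left_mono) auto
  also have "\<dots> = ?D * i" by (simp add: algebra_simps)
  finally have "\<sigma> * (norm (d + \<gamma> *\<^sub>R a))\<^sup>2 / ?D \<le> i"
    using D by (simp add: divide_le_eq mult.commute)
  then have "4 * \<gamma> * (\<sigma> * (norm (d + \<gamma> *\<^sub>R a))\<^sup>2 / ?D) \<le> 4 * \<gamma> * i"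
    using g by (intro mult_left_mono) auto
  then have "4 * \<gamma> * \<sigma> / ?D * (norm (d + \<gamma> *\<^sub>R a))\<^sup>2 \<le> 4 * \<gamma> * i"
    by (simp add: mult.assoc)
  then have "(norm (d - \<gamma> *\<^sub>R a))\<^sup>2 \<le> (1 - 4 * \<gamma> * \<sigma> / ?D) * (norm (d + \<gamma> *\<^sub>R a))\<^sup>2"
    by (simp add: minus algebra_simps)
  also have "\<dots> = (DR_delta \<sigma> \<beta> \<gamma> * norm (d + \<gamma> *\<^sub>R a))\<^sup>2"
    using DR_delta_radicand_nonneg[OF s g] by (simp add: DR_delta_def power_mult_distrib)
  finally have "norm (d - \<gamma> *\<^sub>R a) \<le> DR_delta \<sigma> \<beta> \<gamma> * norm (d + \<gamma> *\<^sub>R a)"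
    using DR_delta_bounds[OF s g] by (auto intro: power2_le_imp_le)
  then show ?thesis by (simp add: R zw)
qed

lemma DR_operator_Lipschitz:
  fixes A :: "'a::{real_inner, complete_space} \<Rightarrow> 'a"
  assumes s: "0 < \<sigma>" "\<sigma> \<le> \<beta>" and g: "0 < \<gamma>" and \<alpha>: "0 < \<alpha>"
    and max: "maximally_monotone (single_valued_op A)" "maximally_monotone B"
    and strong: "strongly_monotone \<sigma> (single_valued_op A)" and coco: "cocoercive (1 / \<beta>) A"
  shows "norm (DR_operator \<alpha> \<gamma> (single_valued_op A) B z - DR_operator \<alpha> \<gamma> (single_valued_op A) B w)
         \<le> DR_rate_bound \<sigma> \<beta> \<alpha> \<gamma> * norm (z - w)"
proof -
  let ?RA = "reflected_resolvent (scaled_op \<gamma> (single_valued_op A))"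
  let ?RB = "reflected_resolvent (scaled_op \<gamma> B)"
  have "norm (?RA (?RB z) - ?RA (?RB w)) \<le> DR_delta \<sigma> \<beta> \<gamma> * norm (?RB z - ?RB w)"
    by (intro reflected_resolvent_contraction s g max strong coco)
  also have "\<dots> \<le> DR_delta \<sigma> \<beta> \<gamma> * norm (z - w)"
    by (intro mult_left_mono reflected_resolvent_nonexpansive maximally_monotone_scaled_op
        DR_delta_bounds s g max)
  finally have R: "norm (?RA (?RB z) - ?RA (?RB w)) \<le> DR_delta \<sigma> \<beta> \<gamma> * norm (z - w)" .
  have "DR_operator \<alpha> \<gamma> (single_valued_op A) B z - DR_operator \<alpha> \<gamma> (single_valued_op A) B w
      = (1 - \<alpha>) *\<^sub>R (z - w) + \<alpha> *\<^sub>R (?RA (?RB z) - ?RA (?RB w))"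
    by (simp add: DR_operator_def algebra_simps)
  also have "norm \<dots> \<le> \<bar>1 - \<alpha>\<bar> * norm (z - w) + \<alpha> * norm (?RA (?RB z) - ?RA (?RB w))"
    using \<alpha> by (intro order_trans[OF norm_triangle_ineq]) simp
  also have "\<dots> \<le> \<bar>1 - \<alpha>\<bar> * norm (z - w) + \<alpha> * (DR_delta \<sigma> \<beta> \<gamma> * norm (z - w))"
    using R \<alpha> by (intro add_left_mono mult_left_mono) auto
  finally show ?thesis by (simp add: DR_rate_bound_def algebra_simps)
qed

lemma contraction_converges_with_rate_factor:
  fixes T :: "'a::{real_normed_vector, complete_space} \<Rightarrow> 'a"
  assumes "0 \<le> \<rho>" "\<rho> < 1" and lip: "\<And>z w. norm (T z - T w) \<le> \<rho> * norm (z - w)"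
  shows "converges_with_rate_factor T \<rho>"
proof -
  have "\<exists>!z. T z = z"
    using assms by (intro banach_fix_type[of \<rho>]) (auto simp: dist_norm)
  then obtain zbar where zbar: "\<And>z. T z = z \<longleftrightarrow> z = zbar" by metis
  have "norm ((T ^^ Suc k) z0 - zbar) \<le> \<rho> * norm ((T ^^ k) z0 - zbar)" for z0 k
    using lip[of "(T ^^ k) z0" zbar] zbar[of zbar] by simp
  with zbar show ?thesis
    unfolding converges_with_rate_factor_def using assms by blast
qed

section \<open>The optimal parameters\<close>

lemma DR_rate_bound_nonneg_less_one:
  assumes s: "0 < \<sigma>" "\<sigma> \<le> \<beta>" and adm: "DR_admissible \<sigma> \<beta> \<alpha> \<gamma>"
  shows "0 \<le> DR_rate_bound \<sigma> \<beta> \<alpha> \<gamma>" "DR_rate_bound \<sigma> \<beta> \<alpha> \<gamma> < 1"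
proof -
  have g: "0 < \<gamma>" and \<alpha>: "0 < \<alpha>" "\<alpha> < 2 / (1 + DR_delta \<sigma> \<beta> \<gamma>)"
    using adm by (auto simp: DR_admissible_def)
  note delta = DR_delta_bounds[OF s g]
  show "0 \<le> DR_rate_bound \<sigma> \<beta> \<alpha> \<gamma>"
    using \<alpha> delta by (simp add: DR_rate_bound_def)
  have "\<alpha> * (1 + DR_delta \<sigma> \<beta> \<gamma>) < 2" using \<alpha> delta by (simp add: field_simps)
  moreover have "\<alpha> * DR_delta \<sigma> \<beta> \<gamma> < \<alpha>" using \<alpha> delta by simp
  ultimately show "DR_rate_bound \<sigma> \<beta> \<alpha> \<gamma> < 1"
    by (auto simp: DR_rate_bound_def abs_if algebra_simps)
qed

lemma DR_admissible_one:
  assumes "0 < \<sigma>" "\<sigma> \<le> \<beta>" "0 < \<gamma>"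
  shows "DR_admissible \<sigma> \<beta> 1 \<gamma>"
  using DR_delta_bounds[OF assms] assms by (simp add: DR_admissible_def field_simps)

lemma DR_rate_bound_one: "DR_rate_bound \<sigma> \<beta> 1 \<gamma> = DR_delta \<sigma> \<beta> \<gamma>"
  by (simp add: DR_rate_bound_def)

text \<open>For fixed \<open>\<gamma>\<close> the best relaxation is \<open>\<alpha> = 1\<close>, and it is the only one, because \<open>\<delta> < 1\<close>.\<close>

lemma DR_delta_less_rate_bound:
  assumes s: "0 < \<sigma>" "\<sigma> \<le> \<beta>" "0 < \<gamma>" and ne: "\<alpha> \<noteq> 1"
  shows "DR_delta \<sigma> \<beta> \<gamma> < DR_rate_bound \<sigma> \<beta> \<alpha> \<gamma>"
proof (cases "\<alpha> < 1")
  case True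
  have "0 < (1 - \<alpha>) * (1 - DR_delta \<sigma> \<beta> \<gamma>)"
    using True DR_delta_bounds[OF s] by simp
  with True show ?thesis by (simp add: DR_rate_bound_def algebra_simps)
next
  case False
  with ne have "0 < (\<alpha> - 1) * (1 + DR_delta \<sigma> \<beta> \<gamma>)"
    using DR_delta_bounds[OF s] by (intro mult_pos_pos) auto
  with False show ?thesis by (simp add: DR_rate_bound_def algebra_simps)
qed

lemma DR_delta_at_optimum:
  assumes s: "0 < \<sigma>" "0 < \<beta>"
  shows "DR_delta \<sigma> \<beta> (1 / sqrt (\<beta> * \<sigma>)) = sqrt (1 - 2 * \<sigma> / (sqrt (\<beta> * \<sigma>) + \<sigma>))"
proof -
  define r where "r = sqrt (\<beta> * \<sigma>)"
  have r: "0 < r" "r\<^sup>2 = \<beta> * \<sigma>" using s by (auto simp: r_def)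
  have "1 + 2 * (1 / r) * \<sigma> + (1 / r)\<^sup>2 * \<sigma> * \<beta> = 2 * (r + \<sigma>) / r"
    using r by (simp add: power_divide mult.assoc mult.commute[of \<sigma> \<beta>] flip: r(2))
      (simp add: field_simps)
  then have "4 * (1 / r) * \<sigma> / (1 + 2 * (1 / r) * \<sigma> + (1 / r)\<^sup>2 * \<sigma> * \<beta>) = 2 * \<sigma> / (r + \<sigma>)"
    using r s by (simp add: field_simps)
  then show ?thesis by (simp add: DR_delta_def flip: r_def)
qed

text \<open>Writing \<open>r = \<surd>(\<beta>\<sigma>)\<close>, the fraction in \<open>\<delta>\<close> is \<open>4\<sigma>/(1/\<gamma> + 2\<sigma> + \<gamma>r\<^sup>2)\<close>, whose denominator exceeds
  \<open>2r + 2\<sigma>\<close> by \<open>(\<gamma>r - 1)\<^sup>2/\<gamma>\<close>.\<close>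

lemma DR_delta_optimum_less:
  assumes s: "0 < \<sigma>" "0 < \<beta>" and g: "0 < \<gamma>" "\<gamma> \<noteq> 1 / sqrt (\<beta> * \<sigma>)"
  shows "DR_delta \<sigma> \<beta> (1 / sqrt (\<beta> * \<sigma>)) < DR_delta \<sigma> \<beta> \<gamma>"
proof -
  define r where "r = sqrt (\<beta> * \<sigma>)"
  have r: "0 < r" "r\<^sup>2 = \<beta> * \<sigma>" using s by (auto simp: r_def)
  let ?D = "1 + 2 * \<gamma> * \<sigma> + \<gamma>\<^sup>2 * \<sigma> * \<beta>"
  have D: "0 < ?D" using s g(1) by (rule DR_delta_denominator_pos)
  have "\<gamma> * r \<noteq> 1" using g(2) r(1) by (metis nonzero_eq_divide_eq less_irrefl r_def)
  then have "0 < (\<gamma> * r - 1)\<^sup>2" by simp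
  also have "\<dots> = 1 - 2 * \<gamma> * r + \<gamma>\<^sup>2 * (\<beta> * \<sigma>)"
    by (simp add: power2_diff power_mult_distrib r(2))
  finally have "2 * \<gamma> * (r + \<sigma>) < ?D" by (simp add: algebra_simps)
  then have "2 * \<sigma> * (2 * \<gamma> * (r + \<sigma>)) < 2 * \<sigma> * ?D" using s by simp
  then have "4 * \<gamma> * \<sigma> * (r + \<sigma>) < 2 * \<sigma> * ?D" by (simp add: mult_ac)
  then have "4 * \<gamma> * \<sigma> / ?D < 2 * \<sigma> / (r + \<sigma>)"
    using r s D by (simp add: divide_less_eq less_divide_eq mult_ac)
  then show ?thesis
    unfolding DR_delta_at_optimum[OF s] by (simp add: DR_delta_def r_def)
qed

lemma DR_delta_optimum_eq:
  assumes s: "0 < \<sigma>" "0 < \<beta>"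
  shows "DR_delta \<sigma> \<beta> (1 / sqrt (\<beta> * \<sigma>)) = sqrt ((sqrt (\<beta> / \<sigma>) - 1) / (sqrt (\<beta> / \<sigma>) + 1))"
proof -
  define q where "q = sqrt (\<beta> / \<sigma>)"
  have q: "0 < q" using s by (simp add: q_def)
  have "sqrt (\<beta> * \<sigma>) = sqrt (\<beta> / \<sigma> * \<sigma>\<^sup>2)" using s by (simp add: power2_eq_square)
  also have "\<dots> = q * \<sigma>" using s by (simp add: q_def real_sqrt_mult del: times_divide_eq_left)
  finally have "sqrt (\<beta> * \<sigma>) = q * \<sigma>" .
  moreover have "1 - 2 * \<sigma> / (q * \<sigma> + \<sigma>) = (q - 1) / (q + 1)"
  proof -
    have "2 * \<sigma> / (q * \<sigma> + \<sigma>) = 2 * \<sigma> / ((q + 1) * \<sigma>)" by (simp add: algebra_simps)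
    also have "\<dots> = 2 / (q + 1)" using s by simp
    finally show ?thesis using q by (simp add: field_simps)
  qed
  ultimately show ?thesis unfolding DR_delta_at_optimum[OF s] by (simp add: q_def)
qed

lemma DR_rate_bound_strict_min:
  assumes s: "0 < \<sigma>" "\<sigma> \<le> \<beta>" and g: "0 < \<gamma>"
    and ne: "(\<alpha>, \<gamma>) \<noteq> (1, 1 / sqrt (\<beta> * \<sigma>))"
  shows "DR_rate_bound \<sigma> \<beta> 1 (1 / sqrt (\<beta> * \<sigma>)) < DR_rate_bound \<sigma> \<beta> \<alpha> \<gamma>"
proof (cases "\<gamma> = 1 / sqrt (\<beta> * \<sigma>)")
  case True
  with ne have "\<alpha> \<noteq> 1" by simp
  from DR_delta_less_rate_bound[OF s g this] True show ?thesis
    by (simp add: DR_rate_bound_one)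
next
  case False
  have "DR_delta \<sigma> \<beta> (1 / sqrt (\<beta> * \<sigma>)) < DR_delta \<sigma> \<beta> \<gamma>"
    using s g False by (intro DR_delta_optimum_less) auto
  also have "\<dots> \<le> DR_rate_bound \<sigma> \<beta> \<alpha> \<gamma>"
    using DR_delta_less_rate_bound[OF s g, of \<alpha>] DR_rate_bound_one[of \<sigma> \<beta> \<gamma>]
    by (cases "\<alpha> = 1") auto
  finally show ?thesis by (simp add: DR_rate_bound_one)
qed

lemma is_arg_min_DR_rate_bound_iff:
  assumes s: "0 < \<sigma>" "\<sigma> \<le> \<beta>"
  shows "is_arg_min (\<lambda>(\<alpha>, \<gamma>). DR_rate_bound \<sigma> \<beta> \<alpha> \<gamma>)
           (\<lambda>(\<alpha>, \<gamma>). DR_admissible \<sigma> \<beta> \<alpha> \<gamma>) (\<alpha>, \<gamma>)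
         \<longleftrightarrow> \<alpha> = 1 \<and> \<gamma> = 1 / sqrt (\<beta> * \<sigma>)"
proof -
  let ?g = "1 / sqrt (\<beta> * \<sigma>)"
  have opt: "DR_admissible \<sigma> \<beta> 1 ?g" using s by (intro DR_admissible_one) auto
  have strict: "DR_rate_bound \<sigma> \<beta> 1 ?g < DR_rate_bound \<sigma> \<beta> a c"
    if "DR_admissible \<sigma> \<beta> a c" "(a, c) \<noteq> (1, ?g)" for a c
    using that s by (intro DR_rate_bound_strict_min) (auto simp: DR_admissible_def)
  show ?thesis
  proof
    assume "is_arg_min (\<lambda>(\<alpha>, \<gamma>). DR_rate_bound \<sigma> \<beta> \<alpha> \<gamma>)
           (\<lambda>(\<alpha>, \<gamma>). DR_admissible \<sigma> \<beta> \<alpha> \<gamma>) (\<alpha>, \<gamma>)"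
    with opt strict[of \<alpha> \<gamma>] show "\<alpha> = 1 \<and> \<gamma> = ?g"
      unfolding is_arg_min_def by auto
  next
    assume "\<alpha> = 1 \<and> \<gamma> = ?g"
    moreover have "\<not> DR_rate_bound \<sigma> \<beta> a c < DR_rate_bound \<sigma> \<beta> 1 ?g"
      if "DR_admissible \<sigma> \<beta> a c" for a c
      using strict[OF that] by (cases "(a, c) = (1, ?g)") auto
    ultimately show "is_arg_min (\<lambda>(\<alpha>, \<gamma>). DR_rate_bound \<sigma> \<beta> \<alpha> \<gamma>)
           (\<lambda>(\<alpha>, \<gamma>). DR_admissible \<sigma> \<beta> \<alpha> \<gamma>) (\<alpha>, \<gamma>)"
      using opt unfolding is_arg_min_def by auto
  qed
qed

section \<open>The convergence rate of Douglas-Rachford splitting\<close>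

theorem theorem7p4:
  fixes \<sigma> \<beta> :: real
    and A :: "'a::{real_inner, complete_space} \<Rightarrow> 'a"
    and B :: "'a \<Rightarrow> 'a set"
  assumes "separable_space (euclidean :: 'a topology)"
    and "(UNIV :: 'a set) \<noteq> {0}"
    and "\<sigma> > 0" and "\<beta> > 0"
    and "maximally_monotone (single_valued_op A)"
    and "maximally_monotone B"
    and "strongly_monotone \<sigma> (single_valued_op A)"
    and "cocoercive (1 / \<beta>) A"
  shows "(\<forall>\<alpha> \<gamma>. DR_admissible \<sigma> \<beta> \<alpha> \<gamma> \<longrightarrow>
            converges_with_rate_factor (DR_operator \<alpha> \<gamma> (single_valued_op A) B)
              (DR_rate_bound \<sigma> \<beta> \<alpha> \<gamma>))
       \<and> (\<forall>\<alpha> \<gamma>. is_arg_min (\<lambda>(\<alpha>, \<gamma>). DR_rate_bound \<sigma> \<beta> \<alpha> \<gamma>)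
                   (\<lambda>(\<alpha>, \<gamma>). DR_admissible \<sigma> \<beta> \<alpha> \<gamma>) (\<alpha>, \<gamma>)
                 \<longleftrightarrow> \<alpha> = 1 \<and> \<gamma> = 1 / sqrt (\<beta> * \<sigma>))
       \<and> DR_rate_bound \<sigma> \<beta> 1 (1 / sqrt (\<beta> * \<sigma>))
           = sqrt ((sqrt (\<beta> / \<sigma>) - 1) / (sqrt (\<beta> / \<sigma>) + 1))"
proof -
  have s: "0 < \<sigma>" "\<sigma> \<le> \<beta>"
    using assms strong_monotonicity_le_cocoercivity[of \<sigma> \<beta> A] by auto
  have "converges_with_rate_factor (DR_operator \<alpha> \<gamma> (single_valued_op A) B)
          (DR_rate_bound \<sigma> \<beta> \<alpha> \<gamma>)"
    if adm: "DR_admissible \<sigma> \<beta> \<alpha> \<gamma>" for \<alpha> \<gamma>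
  proof (rule contraction_converges_with_rate_factor)
    show "0 \<le> DR_rate_bound \<sigma> \<beta> \<alpha> \<gamma>" "DR_rate_bound \<sigma> \<beta> \<alpha> \<gamma> < 1"
      using DR_rate_bound_nonneg_less_one[OF s adm] by auto
    show "norm (DR_operator \<alpha> \<gamma> (single_valued_op A) B z
              - DR_operator \<alpha> \<gamma> (single_valued_op A) B w)
          \<le> DR_rate_bound \<sigma> \<beta> \<alpha> \<gamma> * norm (z - w)" for z w
      using adm assms s by (intro DR_operator_Lipschitz) (auto simp: DR_admissible_def)
  qed
  then show ?thesis
    using is_arg_min_DR_rate_bound_iff[OF s] DR_delta_optimum_eq[OF assms(3,4)]
    by (simp add: DR_rate_bound_one)
qed

end
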